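(* Let $(G^\theta)_{\theta\in\Theta}$, $G^\theta=\langle\mathcal{I},(\mathcal{A}_i,u_i^\theta)_{i\in\mathcal{I}},\mathcal{X},\mathcal{E},\psi^\theta,f,\delta\rangle$, be a parameterized family of basic games satisfying the baseline assumptions given in the context, $\phi:\mathcal{X}\to\Delta(\mathcal{A})$ the known conditional choice probabilities, $S=((\mathcal{T}_i)_i,\pi)$ a fixed information structure, and $\Theta_I\equiv\Theta_I^{\mathit{MCE}}(S)$. Then $\theta\in\Theta_I$ if and only if there exists a pair $(\sigma,V)$, with $\sigma=(\sigma_{a\mid x,\varepsilon,\tau})$ and $V=(V_{i,x})_{i\in\mathcal{I},x\in\mathcal{X}}$ real vectors, satisfying $$\sigma_{a\mid x,\varepsilon,\tau}\ge 0\ \text{ for each } a\ \text{ and }\ \sum_a\sigma_{a\mid x,\varepsilon,\tau}=1,\quad\forall x,\varepsilon,\tau,$$ $$\phi_{a\mid x}=\sum_{\varepsilon,\tau}\psi^\theta_{\varepsilon\mid x}\pi_{\tau\mid x,\varepsilon}\sigma_{a\mid x,\varepsilon,\tau},\quad\forall a,x,$$ $$\sum_{\varepsilon,\tau_{-i},a_{-i}}\psi^\theta_{\varepsilon\mid x}\pi_{\tau\mid x,\varepsilon}\sigma_{a\mid x,\varepsilon,\tau}\,\partial v_i^\theta(a_i',a,x,\varepsilon_i)\le 0,\quad\forall i,x,\tau_i,a_i,a_i',$$ $$V_{i,x}=\sum_{\varepsilon,\tau,a}\psi^\theta_{\varepsilon\mid x}\pi_{\tau\mid x,\varepsilon}\sigma_{a\mid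 x,\varepsilon,\tau}u_i^\theta(a,x,\varepsilon_i)+\delta\sum_{a,x'}\phi_{a\mid x}V_{i,x'}f_{x'\mid a,x},\quad\forall i,x,$$ where $v_i^\theta(a,x,\varepsilon_i)\equiv u_i^\theta(a,x,\varepsilon_i)+\delta\sum_{x'}V_{i,x'}f_{x'\mid a,x}$ and $\partial v_i^\theta(a_i',a,x,\varepsilon_i)\equiv v_i^\theta(a_i',a_{-i},x,\varepsilon_i)-v_i^\theta(a_i,a_{-i},x,\varepsilon_i)$.
   Context: **Games.** $\Delta(Y)$ is the set of probability distributions on a finite set $Y$. A basic game $G=\langle \mathcal{I},(\mathcal{A}_i,u_i)_{i\in\mathcal{I}},\mathcal{X},\mathcal{E},\psi,f,\delta\rangle$ consists of players $\mathcal{I}=\{1,\dots,I\}$, finite nonempty action sets $\mathcal{A}_i$ with $\mathcal{A}=\times_i\mathcal{A}_i$, a finite set $\mathcal{X}$ of public states, a finite set $\mathcal{E}$ of latent states, a prior $\psi_{\varepsilon\mid x}$ (for each $x$ a distribution on $\mathcal{E}$), transition probabilities $f_{x'\mid a,x,\varepsilon}$, flow payoffs $u_i:\mathcal{A}\times\mathcal{X}\times\mathcal{E}\to\mathbb{R}$, and a discount factor $\delta\in[0,1)$. An information structure $S=((\mathcal{T}_i)_{i\in\mathcal{I}},\pi)$ consists of finite nonempty signal sets $\mathcal{T}_i$, $\mathcal{T}=\times_i\mathcal{T}_i$, and $\pi:\mathcal{X}\times\mathcal{E}\to\Delta(\mathcal{T})$, written $\pi_{\tau\mid x,\varepsilon}$.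 **Baseline assumptions.** $\mathcal{X}$ and $\mathcal{E}$ are finite; $\psi^\theta$ and $u_i^\theta$ are known up to the finite-dimensional parameter $\theta\in\Theta$; latent states are vectors of player-specific shocks $\varepsilon=(\varepsilon_1,\dots,\varepsilon_I)$, $\varepsilon_i\in\mathcal{E}_i$, with $u_i^\theta(a,x,\varepsilon)=u_i^\theta(a,x,\varepsilon_i)$; $f_{x'\mid a,x,\varepsilon}=f_{x'\mid a,x}$; the conditional choice probabilities $\phi:\mathcal{X}\to\Delta(\mathcal{A})$ and $f:\mathcal{A}\times\mathcal{X}\to\Delta(\mathcal{X})$ are identified from data (treated as known); $\delta$ is known. **Markov correlated equilibrium (MCE).** A decision rule for $(G,S)$ is a map $\sigma:\mathcal{X}\times\mathcal{E}\times\mathcal{T}\to\Delta(\mathcal{A})$. Let $V_i^\sigma\in\mathbb{R}^{|\mathcal{X}|}$ be the unique solution of $V_i^\sigma(x)=\sum_{\varepsilon,\tau,a}\psi_{\varepsilon\mid x}\pi_{\tau\mid x,\varepsilon}\sigma_{a\mid x,\varepsilon,\tau}\{u_i(a,x,\varepsilon)+\delta\sum_{x'}V_i^\sigma(x')f_{x'\mid a,x,\varepsilon}\}$ for all $x$, and $v_i^\sigma(a,x,\varepsilon)=u_i(a,x,\varepsilon)+\delta\sum_{x'}V_i^\sigma(x')f_{x'\mid a,x,\varepsilon}$. Then $\sigma$ is an MCE of $(G,S)$ if for all $i,x,\tau_i,a_i,a_i'$, $$\sum_{\varepsilon,\tau_{-i},a_{-i}}\psi_{\varepsilon\mid x}\pi_{\tau\mid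 x,\varepsilon}\sigma_{a\mid x,\varepsilon,\tau}v_i^\sigma(a,x,\varepsilon)\ge\sum_{\varepsilon,\tau_{-i},a_{-i}}\psi_{\varepsilon\mid x}\pi_{\tau\mid x,\varepsilon}\sigma_{a\mid x,\varepsilon,\tau}v_i^\sigma(a_i',a_{-i},x,\varepsilon).$$ **Identified set.** $\mathcal{P}^{\mathit{MCE}}_{a\mid x}(G,S)$ is the set of maps $x\mapsto\sum_{\varepsilon,\tau}\psi_{\varepsilon\mid x}\pi_{\tau\mid x,\varepsilon}\sigma_{a\mid x,\varepsilon,\tau}$ with $\sigma$ an MCE of $(G,S)$, and $\Theta_I^{\mathit{MCE}}(S)=\{\theta\in\Theta:\phi\in\mathcal{P}^{\mathit{MCE}}_{a\mid x}(G^\theta,S)\}$. *)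

theory Defs
  imports "HOL-Probability.Probability_Mass_Function"
begin

text \<open>
  Profiles are extensional functions on the set of players. A distribution in \<open>\<Delta>(Y)\<close> is a
  \<open>pmf\<close> whose support lies in \<open>Y\<close>. Maps defined on a carrier are total functions
  of which only the values on the carrier are ever used.
\<close>

record ('i, 'a, 'x, 'e) basic_game =
  players  :: "'i set"
  actions  :: "'i \<Rightarrow> 'a set"
  payoff   :: "'i \<Rightarrow> ('i \<Rightarrow> 'a) \<Rightarrow> 'x \<Rightarrow> 'e \<Rightarrow> real"
  states   :: "'x set"
  latents  :: "'e set"
  prior    :: "'x \<Rightarrow> 'e pmf"
  trans    :: "('i \<Rightarrow> 'a) \<Rightarrow> 'x \<Rightarrow> 'e \<Rightarrow> 'x pmf"
  discount :: real

record ('i, 't, 'x, 'e) info_structure =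
  signals     :: "'i \<Rightarrow> 't set"
  signal_dist :: "'x \<Rightarrow> 'e \<Rightarrow> ('i \<Rightarrow> 't) pmf"

definition profiles :: "('i, 'a, 'x, 'e) basic_game \<Rightarrow> ('i \<Rightarrow> 'a) set" where
  "profiles G = Pi\<^sub>E (players G) (actions G)"

definition signal_profiles ::
  "('i, 'a, 'x, 'e) basic_game \<Rightarrow> ('i, 't, 'x, 'e) info_structure \<Rightarrow> ('i \<Rightarrow> 't) set" where
  "signal_profiles G S = Pi\<^sub>E (players G) (signals S)"

definition basic_game :: "('i, 'a, 'x, 'e) basic_game \<Rightarrow> bool" where
  "basic_game G \<longleftrightarrow>
     finite (players G) \<and>
     (\<forall>i\<in>players G. finite (actions G i) \<and> actions G i \<noteq> {}) \<and>
     finite (states G) \<and> finite (latents G) \<and>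
     (\<forall>x\<in>states G. set_pmf (prior G x) \<subseteq> latents G) \<and>
     (\<forall>a\<in>profiles G. \<forall>x\<in>states G. \<forall>e\<in>latents G. set_pmf (trans G a x e) \<subseteq> states G) \<and>
     0 \<le> discount G \<and> discount G < 1"

definition info_structure ::
  "('i, 'a, 'x, 'e) basic_game \<Rightarrow> ('i, 't, 'x, 'e) info_structure \<Rightarrow> bool" where
  "info_structure G S \<longleftrightarrow>
     (\<forall>i\<in>players G. finite (signals S i) \<and> signals S i \<noteq> {}) \<and>
     (\<forall>x\<in>states G. \<forall>e\<in>latents G. set_pmf (signal_dist S x e) \<subseteq> signal_profiles G S)"

type_synonym ('i, 'a, 'x, 'e, 't) decision_rule = "'x \<Rightarrow> 'e \<Rightarrow> ('i \<Rightarrow> 't) \<Rightarrow> ('i \<Rightarrow> 'a) pmf"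

definition decision_rule ::
  "('i, 'a, 'x, 'e) basic_game \<Rightarrow> ('i, 't, 'x, 'e) info_structure
     \<Rightarrow> ('i, 'a, 'x, 'e, 't) decision_rule \<Rightarrow> bool" where
  "decision_rule G S \<sigma> \<longleftrightarrow>
     (\<forall>x\<in>states G. \<forall>e\<in>latents G. \<forall>\<tau>\<in>signal_profiles G S. set_pmf (\<sigma> x e \<tau>) \<subseteq> profiles G)"

definition action_value ::
  "('i, 'a, 'x, 'e) basic_game \<Rightarrow> 'i \<Rightarrow> ('x \<Rightarrow> real) \<Rightarrow> ('i \<Rightarrow> 'a) \<Rightarrow> 'x \<Rightarrow> 'e \<Rightarrow> real" where
  "action_value G i W a x e =
     payoff G i a x e + discount G * (\<Sum>x'\<in>states G. W x' * pmf (trans G a x e) x')"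

text \<open>Extensionality makes the solution of the value equations unique as a total function.\<close>

definition is_value ::
  "('i, 'a, 'x, 'e) basic_game \<Rightarrow> ('i, 't, 'x, 'e) info_structure
     \<Rightarrow> ('i, 'a, 'x, 'e, 't) decision_rule \<Rightarrow> 'i \<Rightarrow> ('x \<Rightarrow> real) \<Rightarrow> bool" where
  "is_value G S \<sigma> i W \<longleftrightarrow>
     W \<in> extensional (states G) \<and>
     (\<forall>x\<in>states G. W x =
        (\<Sum>e\<in>latents G. \<Sum>\<tau>\<in>signal_profiles G S. \<Sum>a\<in>profiles G.
           pmf (prior G x) e * pmf (signal_dist S x e) \<tau> * pmf (\<sigma> x e \<tau>) a * action_value G i W a x e))"

definition eq_value ::
  "('i, 'a, 'x, 'e) basic_game \<Rightarrow> ('i, 't, 'x, 'e) info_structure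
     \<Rightarrow> ('i, 'a, 'x, 'e, 't) decision_rule \<Rightarrow> 'i \<Rightarrow> 'x \<Rightarrow> real" where
  "eq_value G S \<sigma> i = (THE W. is_value G S \<sigma> i W)"

text \<open>
  A sum over \<open>(\<tau>\<^sub>-\<^sub>i, a\<^sub>-\<^sub>i)\<close> with \<open>(\<tau>\<^sub>i, a\<^sub>i) = (t, b)\<close> held fixed is written
  as a sum over the full profiles whose \<open>i\<close>-th coordinates are \<open>t\<close> and \<open>b\<close>.
\<close>

definition markov_correlated_equilibrium ::
  "('i, 'a, 'x, 'e) basic_game \<Rightarrow> ('i, 't, 'x, 'e) info_structure
     \<Rightarrow> ('i, 'a, 'x, 'e, 't) decision_rule \<Rightarrow> bool" where
  "markov_correlated_equilibrium G S \<sigma> \<longleftrightarrow>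
     decision_rule G S \<sigma> \<and>
     (\<forall>i\<in>players G. \<forall>x\<in>states G. \<forall>t\<in>signals S i. \<forall>b\<in>actions G i. \<forall>b'\<in>actions G i.
        (\<Sum>e\<in>latents G. \<Sum>\<tau> | \<tau> \<in> signal_profiles G S \<and> \<tau> i = t. \<Sum>a | a \<in> profiles G \<and> a i = b.
           pmf (prior G x) e * pmf (signal_dist S x e) \<tau> * pmf (\<sigma> x e \<tau>) a
             * action_value G i (eq_value G S \<sigma> i) a x e)
        \<ge>
        (\<Sum>e\<in>latents G. \<Sum>\<tau> | \<tau> \<in> signal_profiles G S \<and> \<tau> i = t. \<Sum>a | a \<in> profiles G \<and> a i = b.
           pmf (prior G x) e * pmf (signal_dist S x e) \<tau> * pmf (\<sigma> x e \<tau>) a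
             * action_value G i (eq_value G S \<sigma> i) (a(i := b')) x e))"

definition mce_ccps ::
  "('i, 'a, 'x, 'e) basic_game \<Rightarrow> ('i, 't, 'x, 'e) info_structure
     \<Rightarrow> ('x \<Rightarrow> ('i \<Rightarrow> 'a) pmf) set" where
  "mce_ccps G S = {p. \<exists>\<sigma>. markov_correlated_equilibrium G S \<sigma> \<and>
     (\<forall>x\<in>states G. \<forall>a\<in>profiles G. pmf (p x) a =
        (\<Sum>e\<in>latents G. \<Sum>\<tau>\<in>signal_profiles G S.
           pmf (prior G x) e * pmf (signal_dist S x e) \<tau> * pmf (\<sigma> x e \<tau>) a))}"

definition identified_set ::
  "'p set \<Rightarrow> ('p \<Rightarrow> ('i, 'a, 'x, 'e) basic_game) \<Rightarrow> ('x \<Rightarrow> ('i \<Rightarrow> 'a) pmf)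
     \<Rightarrow> ('i, 't, 'x, 'e) info_structure \<Rightarrow> 'p set" where
  "identified_set \<Theta> G \<phi> S = {\<theta> \<in> \<Theta>. \<phi> \<in> mce_ccps (G \<theta>) S}"

text \<open>
  The game \<open>G\<^sup>\<theta>\<close> under the baseline assumptions: only payoffs and prior depend on the
  parameter, player \<open>i\<close>'s payoff depends on the latent state \<open>\<epsilon>\<close> only through
  the shock \<open>\<epsilon> i\<close>, and transitions do not depend on \<open>\<epsilon>\<close>.
\<close>

definition param_game ::
  "'i set \<Rightarrow> ('i \<Rightarrow> 'a set) \<Rightarrow> ('p \<Rightarrow> 'i \<Rightarrow> ('i \<Rightarrow> 'a) \<Rightarrow> 'x \<Rightarrow> 's \<Rightarrow> real) \<Rightarrow> 'x set
     \<Rightarrow> ('i \<Rightarrow> 's) set \<Rightarrow> ('p \<Rightarrow> 'x \<Rightarrow> ('i \<Rightarrow> 's) pmf) \<Rightarrow> (('i \<Rightarrow> 'a) \<Rightarrow> 'x \<Rightarrow> 'x pmf) \<Rightarrow> real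
     \<Rightarrow> 'p \<Rightarrow> ('i, 'a, 'x, 'i \<Rightarrow> 's) basic_game" where
  "param_game I A u X E \<psi> f \<delta> \<theta> =
     \<lparr> players = I, actions = A, payoff = (\<lambda>i a x \<epsilon>. u \<theta> i a x (\<epsilon> i)), states = X, latents = E,
       prior = \<psi> \<theta>, trans = (\<lambda>a x \<epsilon>. f a x), discount = \<delta> \<rparr>"

end

theory Submission
  imports Defs
begin

text \<open>
  The conditions in the theorem are those of an MCE with choice probabilities \<open>\<phi>\<close>, except that the
  value function is an unknown \<open>V\<close> and the continuation value in its recursion is averaged with
  \<open>\<phi>\<close>. As transitions ignore the latent state, that term depends on the decision rule only
  through its choice probabilities, which is what makes the recursion linear in \<open>(\<sigma>, V)\<close>. Since
  \<open>\<delta> < 1\<close> and the state transition kernel induced by a decision rule is stochastic, the recursion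
  has exactly one solution, so \<open>V\<close> is forced to be the value function of the decision rule.
\<close>

section \<open>Discounted linear recursions on a finite state space\<close>

text \<open>A substochastic kernel does not increase the sup norm, so at a state where
  \<open>\<bar>d\<bar>\<close> attains its maximum \<open>M\<close> the equation gives
  \<open>M \<le> \<delta> * M\<close>, which forces \<open>M \<le> 0\<close>. Applied to the
  difference of two solutions, this is uniqueness.\<close>

lemma discounted_homogeneous_zero:
  fixes K :: "'x \<Rightarrow> 'x \<Rightarrow> real"
  assumes "finite X" "0 \<le> \<delta>" "\<delta> < 1"
    and K: "\<And>x y. x \<in> X \<Longrightarrow> y \<in> X \<Longrightarrow> 0 \<le> K x y" "\<And>x. x \<in> X \<Longrightarrow> (\<Sum>y\<in>X. K x y) \<le> 1"
    and d: "\<And>x. x \<in> X \<Longrightarrow> d x = \<delta> * (\<Sum>y\<in>X. K x y * d y)"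
    and "x \<in> X"
  shows "d x = 0"
proof -
  define M where "M = Max ((\<lambda>x. \<bar>d x\<bar>) ` X)"
  have le: "\<bar>d y\<bar> \<le> M" if "y \<in> X" for y
    unfolding M_def using assms(1) that by auto
  \<comment> \<open>The given state \<open>x\<close> makes the image nonempty, so the maximum is
    attained.\<close>
  have "M \<in> (\<lambda>x. \<bar>d x\<bar>) ` X"
    unfolding M_def using assms(1) \<open>x \<in> X\<close> by (intro Max_in) auto
  then obtain z where z: "z \<in> X" "M = \<bar>d z\<bar>" by auto
  then have M0: "0 \<le> M" by simp
  have "\<bar>\<Sum>y\<in>X. K z y * d y\<bar> \<le> (\<Sum>y\<in>X. K z y * M)"
    by (rule order_trans[OF sum_abs]) (auto intro!: sum_mono mult_left_mono simp: abs_mult K z(1) le)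
  also have "\<dots> = (\<Sum>y\<in>X. K z y) * M"
    by (simp add: sum_distrib_right)
  also have "\<dots> \<le> M"
    using mult_right_mono[OF K(2)[OF z(1)] M0] by simp
  finally have "M \<le> \<delta> * M"
    using d[OF z(1)] z(2) assms(2) by (simp add: abs_mult mult_left_mono)
  then have "(1 - \<delta>) * M \<le> 0" by (simp add: algebra_simps)
  then have "M \<le> 0" using assms(3) by (simp add: mult_le_0_iff)
  then show ?thesis using le[OF \<open>x \<in> X\<close>] by simp
qed

text \<open>The solution is the Neumann series \<open>\<Sum>n. \<delta> ^ n * K\<^sup>n r\<close>.\<close>

lemma discounted_solution_exists:
  fixes K :: "'x \<Rightarrow> 'x \<Rightarrow> real"
  assumes "finite X" "0 \<le> \<delta>" "\<delta> < 1"
    and K: "\<And>x y. x \<in> X \<Longrightarrow> y \<in> X \<Longrightarrow> 0 \<le> K x y" "\<And>x. x \<in> X \<Longrightarrow> (\<Sum>y\<in>X. K x y) \<le> 1"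
  shows "\<exists>W. \<forall>x\<in>X. W x = r x + \<delta> * (\<Sum>y\<in>X. K x y * W y)"
proof -
  \<comment> \<open>\<open>R n\<close> is the \<open>n\<close>-th kernel iterate of
    \<open>r\<close>. The bound \<open>C\<close> below dominates \<open>\<bar>r\<bar>\<close> on
    \<open>X\<close>, and row sums at most 1 carry it to every iterate, so a geometric series
    dominates the Neumann series.\<close>
  define R where "R = (\<lambda>n. ((\<lambda>g x. \<Sum>y\<in>X. K x y * g y) ^^ n) r)"
  define C where "C = (\<Sum>x\<in>X. \<bar>r x\<bar>)"
  have C0: "0 \<le> C" unfolding C_def by (simp add: sum_nonneg)
  have R_0: "R 0 = r" and R_Suc: "R (Suc n) x = (\<Sum>y\<in>X. K x y * R n y)" for n x
    by (simp_all add: R_def)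
  have bound: "\<bar>R n x\<bar> \<le> C" if "x \<in> X" for n x
    using that
  proof (induction n arbitrary: x)
    case 0
    then show ?case unfolding R_0 C_def using assms(1) by (intro member_le_sum) auto
  next
    case (Suc n)
    have "\<bar>R (Suc n) x\<bar> \<le> (\<Sum>y\<in>X. K x y * C)"
      unfolding R_Suc
      by (rule order_trans[OF sum_abs])
        (auto intro!: sum_mono mult_left_mono simp: abs_mult K Suc)
    also have "\<dots> = (\<Sum>y\<in>X. K x y) * C"
      by (simp add: sum_distrib_right)
    also have "\<dots> \<le> C"
      using mult_right_mono[OF K(2)[OF Suc.prems] C0] by simp
    finally show ?case .
  qed
  have summable: "summable (\<lambda>n. \<delta> ^ n * R n x)" if "x \<in> X" for x
  proof (rule summable_comparison_test)
    show "\<exists>N. \<forall>n\<ge>N. norm (\<delta> ^ n * R n x) \<le> \<delta> ^ n * C"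
      using assms(2) bound[OF that] by (auto simp: abs_mult intro!: mult_left_mono)
    show "summable (\<lambda>n. \<delta> ^ n * C)"
      using assms(2,3) by (intro summable_mult2 summable_geometric) auto
  qed
  define W where "W = (\<lambda>x. \<Sum>n. \<delta> ^ n * R n x)"
  have "W x = r x + \<delta> * (\<Sum>y\<in>X. K x y * W y)" if x: "x \<in> X" for x
  proof -
    \<comment> \<open>The term at 0 is \<open>r x\<close>; each later term is
      \<open>\<delta>\<close> times the kernel applied to its predecessor, so the tail is the
      discounted kernel applied to \<open>W\<close> once the finite sum and the series are
      exchanged.\<close>
    have "W x = r x + (\<Sum>n. \<delta> ^ Suc n * R (Suc n) x)"
      using suminf_split_head[OF summable[OF x]] by (simp add: W_def R_0)
    also have "(\<Sum>n. \<delta> ^ Suc n * R (Suc n) x) = (\<Sum>n. \<Sum>y\<in>X. (\<delta> * K x y) * (\<delta> ^ n * R n y))"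
      by (simp add: R_Suc sum_distrib_left mult_ac)
    also have "\<dots> = (\<Sum>y\<in>X. \<Sum>n. (\<delta> * K x y) * (\<delta> ^ n * R n y))"
      by (rule suminf_sum) (intro summable_mult summable)
    also have "\<dots> = (\<Sum>y\<in>X. (\<delta> * K x y) * W y)"
      unfolding W_def by (intro sum.cong refl suminf_mult summable)
    finally show ?thesis by (simp add: sum_distrib_left mult_ac)
  qed
  then show ?thesis by blast
qed

section \<open>The value function of a decision rule\<close>

text \<open>Bridges \<open>eq_value\<close>, which is extensional, and a vector \<open>V\<close>
  that is arbitrary off the states.\<close>

lemma action_value_cong:
  assumes "\<And>x'. x' \<in> states G \<Longrightarrow> W x' = W' x'"
  shows "action_value G i W a x e = action_value G i W' a x e"
  using assms by (simp add: action_value_def)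

lemma finite_signal_profiles:
  assumes "basic_game G" "info_structure G S"
  shows "finite (signal_profiles G S)"
  using assms by (auto simp: basic_game_def info_structure_def signal_profiles_def intro!: finite_PiE)

lemma finite_profiles: "basic_game G \<Longrightarrow> finite (profiles G)"
  by (auto simp: basic_game_def profiles_def intro!: finite_PiE)

text \<open>The value equation is a discounted recursion whose reward \<open>r\<close> is the
  expected flow payoff and whose kernel \<open>K\<close> is the induced transition law on states.
  This makes the description in \<open>eq_value\<close> meaningful.\<close>

lemma ex1_is_value:
  assumes G: "basic_game G" and S: "info_structure G S" and \<sigma>: "decision_rule G S \<sigma>"
  shows "\<exists>!W. is_value G S \<sigma> i W"
proof -
  \<comment> \<open>The joint probability of latent state, signals and actions given
    \<open>x\<close>.\<close>
  define w where "w = (\<lambda>x e \<tau> a. pmf (prior G x) e * pmf (signal_dist S x e) \<tau> * pmf (\<sigma> x e \<tau>) a)"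
  define r where "r = (\<lambda>x. \<Sum>e\<in>latents G. \<Sum>\<tau>\<in>signal_profiles G S. \<Sum>a\<in>profiles G.
    w x e \<tau> a * payoff G i a x e)"
  define K where "K = (\<lambda>x x'. \<Sum>e\<in>latents G. \<Sum>\<tau>\<in>signal_profiles G S. \<Sum>a\<in>profiles G.
    w x e \<tau> a * pmf (trans G a x e) x')"
  note fin = finite_signal_profiles[OF G S] finite_profiles[OF G]
  have X: "finite (states G)" and E: "finite (latents G)"
    and \<delta>: "0 \<le> discount G" "discount G < 1"
    using G by (auto simp: basic_game_def)
  have rhs: "(\<Sum>e\<in>latents G. \<Sum>\<tau>\<in>signal_profiles G S. \<Sum>a\<in>profiles G.
      w x e \<tau> a * action_value G i W a x e)
    = r x + discount G * (\<Sum>y\<in>states G. K x y * W y)" for x W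
  proof -
    have "(\<Sum>y\<in>states G. K x y * W y) = (\<Sum>y\<in>states G. \<Sum>e\<in>latents G.
        \<Sum>\<tau>\<in>signal_profiles G S. \<Sum>a\<in>profiles G. w x e \<tau> a * (W y * pmf (trans G a x e) y))"
      by (simp add: K_def sum_distrib_left mult_ac)
    also have "\<dots> = (\<Sum>e\<in>latents G. \<Sum>\<tau>\<in>signal_profiles G S. \<Sum>a\<in>profiles G.
        \<Sum>y\<in>states G. w x e \<tau> a * (W y * pmf (trans G a x e) y))"
      \<comment> \<open>Fixing the outer index set orients the swap: the state sum only moves
        inwards.\<close>
      by (simp add: sum.swap[of _ _ "states G"])
    finally show ?thesis
      by (simp add: r_def action_value_def sum_distrib_left distrib_left sum.distrib mult_ac)
  qed
  have is_value_iff: "is_value G S \<sigma> i W \<longleftrightarrow> W \<in> extensional (states G) \<and>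
      (\<forall>x\<in>states G. W x = r x + discount G * (\<Sum>y\<in>states G. K x y * W y))" for W
    unfolding is_value_def rhs[symmetric] w_def ..
  have K0: "0 \<le> K x y" for x y
    by (auto simp: K_def w_def intro!: sum_nonneg)
  \<comment> \<open>Sum from the inside out: transition, decision rule, signal distribution and
    prior each have total mass 1 on their carrier.\<close>
  have K1: "(\<Sum>y\<in>states G. K x y) \<le> 1" if x: "x \<in> states G" for x
  proof -
    have "(\<Sum>y\<in>states G. K x y) = (\<Sum>e\<in>latents G. \<Sum>\<tau>\<in>signal_profiles G S. \<Sum>a\<in>profiles G.
        \<Sum>y\<in>states G. w x e \<tau> a * pmf (trans G a x e) y)"
      by (simp add: K_def sum.swap[of _ _ "states G"])
    also have "\<dots> = (\<Sum>e\<in>latents G. \<Sum>\<tau>\<in>signal_profiles G S. \<Sum>a\<in>profiles G. w x e \<tau> a)"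
    proof (intro sum.cong refl)
      fix e \<tau> a assume "e \<in> latents G" "a \<in> profiles G"
      then have "(\<Sum>y\<in>states G. pmf (trans G a x e) y) = 1"
        using G x by (intro sum_pmf_eq_1) (auto simp: basic_game_def)
      then show "(\<Sum>y\<in>states G. w x e \<tau> a * pmf (trans G a x e) y) = w x e \<tau> a"
        by (simp flip: sum_distrib_left)
    qed
    also have "\<dots> = (\<Sum>e\<in>latents G. \<Sum>\<tau>\<in>signal_profiles G S.
        pmf (prior G x) e * pmf (signal_dist S x e) \<tau>)"
    proof (intro sum.cong refl)
      fix e \<tau> assume "e \<in> latents G" "\<tau> \<in> signal_profiles G S"
      then have "(\<Sum>a\<in>profiles G. pmf (\<sigma> x e \<tau>) a) = 1"
        using \<sigma> x fin by (intro sum_pmf_eq_1) (auto simp: decision_rule_def)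
      then show "(\<Sum>a\<in>profiles G. w x e \<tau> a) = pmf (prior G x) e * pmf (signal_dist S x e) \<tau>"
        by (simp add: w_def flip: sum_distrib_left)
    qed
    also have "\<dots> = (\<Sum>e\<in>latents G. pmf (prior G x) e)"
    proof (intro sum.cong refl)
      fix e assume "e \<in> latents G"
      then have "(\<Sum>\<tau>\<in>signal_profiles G S. pmf (signal_dist S x e) \<tau>) = 1"
        using S x fin by (intro sum_pmf_eq_1) (auto simp: info_structure_def)
      then show "(\<Sum>\<tau>\<in>signal_profiles G S. pmf (prior G x) e * pmf (signal_dist S x e) \<tau>)
          = pmf (prior G x) e"
        by (simp flip: sum_distrib_left)
    qed
    also have "\<dots> = 1"
      using G x E by (intro sum_pmf_eq_1) (auto simp: basic_game_def)
    finally show ?thesis by simp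
  qed
  obtain W where W: "\<And>x. x \<in> states G \<Longrightarrow>
      W x = r x + discount G * (\<Sum>y\<in>states G. K x y * W y)"
    using discounted_solution_exists[of "states G" "discount G" K r] X \<delta> K0 K1 by blast
  show ?thesis
  proof (rule ex1I)
    \<comment> \<open>The solution \<open>W\<close> is arbitrary off the states; restricting it
      gives extensionality and leaves the equations intact.\<close>
    show "is_value G S \<sigma> i (restrict W (states G))"
      using W by (simp add: is_value_iff)
  next
    fix W' assume "is_value G S \<sigma> i W'"
    then have W': "W' \<in> extensional (states G)" "\<And>x. x \<in> states G \<Longrightarrow>
        W' x = r x + discount G * (\<Sum>y\<in>states G. K x y * W' y)"
      by (auto simp: is_value_iff)
    have "W' x - W x = 0" if "x \<in> states G" for x
      using X \<delta> K0 K1 _ that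
    proof (rule discounted_homogeneous_zero)
      show "W' x - W x = discount G * (\<Sum>y\<in>states G. K x y * (W' y - W y))" if "x \<in> states G" for x
        by (subst W'(2)[OF that], subst W[OF that]) (simp add: algebra_simps sum_subtractf)
    qed
    then show "W' = restrict W (states G)"
      using W'(1) by (intro extensionalityI[of _ "states G"]) auto
  qed
qed

lemma is_value_eq_value:
  assumes "basic_game G" "info_structure G S" "decision_rule G S \<sigma>"
  shows "is_value G S \<sigma> i (eq_value G S \<sigma> i)"
  unfolding eq_value_def by (rule theI'[OF ex1_is_value[OF assms]])

lemma eq_value_eqI:
  assumes "basic_game G" "info_structure G S" "decision_rule G S \<sigma>" "is_value G S \<sigma> i W"
  shows "eq_value G S \<sigma> i = W"
  unfolding eq_value_def using assms(4) by (rule the1_equality[OF ex1_is_value[OF assms(1-3)]])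

section \<open>Obedience and values in terms of choice probabilities\<close>

text \<open>The continuation value varies with \<open>a\<close> but not with \<open>e\<close> or
  \<open>\<tau>\<close>, so summing these out of its weights leaves the choice probability of
  \<open>a\<close>.\<close>

lemma value_rhs_ccp:
  assumes trans: "\<And>a e. trans G a x e = f a x"
    and ccp: "\<And>a. a \<in> profiles G \<Longrightarrow> pmf (\<phi> x) a =
      (\<Sum>e\<in>latents G. \<Sum>\<tau>\<in>signal_profiles G S.
        pmf (prior G x) e * pmf (signal_dist S x e) \<tau> * s e \<tau> a)"
  shows "(\<Sum>e\<in>latents G. \<Sum>\<tau>\<in>signal_profiles G S. \<Sum>a\<in>profiles G.
      pmf (prior G x) e * pmf (signal_dist S x e) \<tau> * s e \<tau> a * action_value G i W a x e)
    = (\<Sum>e\<in>latents G. \<Sum>\<tau>\<in>signal_profiles G S. \<Sum>a\<in>profiles G.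
        pmf (prior G x) e * pmf (signal_dist S x e) \<tau> * s e \<tau> a * payoff G i a x e)
      + discount G * (\<Sum>a\<in>profiles G. \<Sum>x'\<in>states G. pmf (\<phi> x) a * W x' * pmf (f a x) x')"
proof -
  define w where "w = (\<lambda>e \<tau> a. pmf (prior G x) e * pmf (signal_dist S x e) \<tau> * s e \<tau> a)"
  define c where "c = (\<lambda>a. \<Sum>x'\<in>states G. W x' * pmf (f a x) x')"
  have action_value: "action_value G i W a x e = payoff G i a x e + discount G * c a" for a e
    by (simp add: action_value_def trans c_def)
  have "(\<Sum>a\<in>profiles G. \<Sum>x'\<in>states G. pmf (\<phi> x) a * W x' * pmf (f a x) x')
      = (\<Sum>a\<in>profiles G. (\<Sum>e\<in>latents G. \<Sum>\<tau>\<in>signal_profiles G S. w e \<tau> a) * c a)"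
    by (intro sum.cong refl) (simp add: ccp w_def c_def sum_distrib_left mult.assoc)
  also have "\<dots> = (\<Sum>a\<in>profiles G. \<Sum>e\<in>latents G. \<Sum>\<tau>\<in>signal_profiles G S. w e \<tau> a * c a)"
    by (simp add: sum_distrib_right)
  also have "\<dots> = (\<Sum>e\<in>latents G. \<Sum>\<tau>\<in>signal_profiles G S. \<Sum>a\<in>profiles G. w e \<tau> a * c a)"
    by (simp add: sum.swap[of _ _ "profiles G"])
  finally show ?thesis
    \<comment> \<open>Folding the weights into \<open>w\<close> turns each product into a single
      factor before distributing.\<close>
    unfolding w_def[THEN fun_cong, THEN fun_cong, THEN fun_cong, symmetric] action_value
    by (simp add: distrib_left sum.distrib sum_distrib_left mult_ac)
qed

text \<open>Forwards, \<open>eq_value\<close> itself serves as \<open>V\<close>. Backwards,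
  uniqueness makes any admissible \<open>V\<close> agree with \<open>eq_value\<close> on the states,
  so both give the same obedience constraints.\<close>

lemma mce_iff_ccp_values:
  assumes G: "basic_game G" and S: "info_structure G S" and \<sigma>: "decision_rule G S \<sigma>"
    and trans: "\<And>a x e. trans G a x e = f a x"
    and ccp: "\<And>x a. x \<in> states G \<Longrightarrow> a \<in> profiles G \<Longrightarrow> pmf (\<phi> x) a =
      (\<Sum>e\<in>latents G. \<Sum>\<tau>\<in>signal_profiles G S.
        pmf (prior G x) e * pmf (signal_dist S x e) \<tau> * pmf (\<sigma> x e \<tau>) a)"
  shows "markov_correlated_equilibrium G S \<sigma> \<longleftrightarrow> (\<exists>V.
    (\<forall>i\<in>players G. \<forall>x\<in>states G. \<forall>t\<in>signals S i. \<forall>b\<in>actions G i. \<forall>b'\<in>actions G i.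
      (\<Sum>e\<in>latents G. \<Sum>\<tau> | \<tau> \<in> signal_profiles G S \<and> \<tau> i = t. \<Sum>a | a \<in> profiles G \<and> a i = b.
        pmf (prior G x) e * pmf (signal_dist S x e) \<tau> * pmf (\<sigma> x e \<tau>) a
          * (action_value G i (V i) (a(i := b')) x e - action_value G i (V i) a x e)) \<le> 0) \<and>
    (\<forall>i\<in>players G. \<forall>x\<in>states G. V i x =
      (\<Sum>e\<in>latents G. \<Sum>\<tau>\<in>signal_profiles G S. \<Sum>a\<in>profiles G.
        pmf (prior G x) e * pmf (signal_dist S x e) \<tau> * pmf (\<sigma> x e \<tau>) a * payoff G i a x e)
      + discount G * (\<Sum>a\<in>profiles G. \<Sum>x'\<in>states G. pmf (\<phi> x) a * V i x' * pmf (f a x) x')))"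
    (is "?mce \<longleftrightarrow> (\<exists>V. ?obedient V \<and> ?values V)")
proof -
  have rhs: "(\<Sum>e\<in>latents G. \<Sum>\<tau>\<in>signal_profiles G S. \<Sum>a\<in>profiles G.
      pmf (prior G x) e * pmf (signal_dist S x e) \<tau> * pmf (\<sigma> x e \<tau>) a * action_value G i W a x e)
    = (\<Sum>e\<in>latents G. \<Sum>\<tau>\<in>signal_profiles G S. \<Sum>a\<in>profiles G.
        pmf (prior G x) e * pmf (signal_dist S x e) \<tau> * pmf (\<sigma> x e \<tau>) a * payoff G i a x e)
      + discount G * (\<Sum>a\<in>profiles G. \<Sum>x'\<in>states G. pmf (\<phi> x) a * W x' * pmf (f a x) x')"
    if "x \<in> states G" for x i W
    by (rule value_rhs_ccp) (use trans ccp that in auto)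
  \<comment> \<open>Splitting the sum of differences recovers the two sides of the equilibrium
    inequality.\<close>
  have mce: "?mce \<longleftrightarrow> ?obedient (eq_value G S \<sigma>)"
    using \<sigma> by (simp add: markov_correlated_equilibrium_def right_diff_distrib sum_subtractf)
  have "?values (eq_value G S \<sigma>)"
    using is_value_eq_value[OF G S \<sigma>] by (auto simp: is_value_def rhs)
  moreover have "?obedient (eq_value G S \<sigma>)" if "?obedient V" "?values V" for V
  proof -
    have "eq_value G S \<sigma> i = restrict (V i) (states G)" if "i \<in> players G" for i
    proof (rule eq_value_eqI[OF G S \<sigma>])
      show "is_value G S \<sigma> i (restrict (V i) (states G))"
        using \<open>?values V\<close> that by (simp add: is_value_def rhs)
    qed
    then have "action_value G i (eq_value G S \<sigma> i) a x e = action_value G i (V i) a x e"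
      if "i \<in> players G" for i a x e
      using that by (intro action_value_cong) simp
    then show ?thesis using \<open>?obedient V\<close> by simp
  qed
  ultimately show ?thesis using mce by blast
qed

section \<open>From real vectors to distributions, and the characterization\<close>

text \<open>Needed since the theorem quantifies over real vectors while decision rules take values
  in distributions.\<close>

lemma pmf_of_weights:
  fixes s :: "'b \<Rightarrow> real"
  assumes "finite P" "\<And>a. a \<in> P \<Longrightarrow> 0 \<le> s a" "(\<Sum>a\<in>P. s a) = 1"
  shows "\<exists>p. set_pmf p \<subseteq> P \<and> (\<forall>a\<in>P. pmf p a = s a)"
proof -
  \<comment> \<open>\<open>embed_pmf\<close> reads weights on the whole type; the default 0 keeps
    the support inside \<open>P\<close>.\<close>
  define g where "g a = (if a \<in> P then s a else 0)" for a
  have "(\<integral>\<^sup>+a. ennreal (g a) \<partial>count_space UNIV) = (\<Sum>a\<in>P. ennreal (g a))"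
    using assms by (intro nn_integral_count_space') (auto simp: g_def)
  also have "\<dots> = ennreal (\<Sum>a\<in>P. g a)"
    using assms(2) by (intro sum_ennreal) (simp add: g_def)
  also have "(\<Sum>a\<in>P. g a) = 1"
    using assms(3) by (simp add: g_def)
  finally have *: "(\<integral>\<^sup>+a. ennreal (g a) \<partial>count_space UNIV) = 1" by simp
  have g0: "0 \<le> g a" for a using assms(2) by (simp add: g_def)
  show ?thesis
  proof (intro exI conjI)
    show "set_pmf (embed_pmf g) \<subseteq> P"
      unfolding set_embed_pmf[OF g0 *] by (auto simp: g_def)
    show "\<forall>a\<in>P. pmf (embed_pmf g) a = s a"
      unfolding pmf_embed_pmf[OF g0 *] by (simp add: g_def)
  qed
qed

theorem theorem5:
  fixes \<Theta> :: "'p::euclidean_space set"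
    and I :: "'i set" and A :: "'i \<Rightarrow> 'a set" and X :: "'x set"
    and Es :: "'i \<Rightarrow> 's set" and E :: "('i \<Rightarrow> 's) set"
    and u :: "'p \<Rightarrow> 'i \<Rightarrow> ('i \<Rightarrow> 'a) \<Rightarrow> 'x \<Rightarrow> 's \<Rightarrow> real"
    and \<psi> :: "'p \<Rightarrow> 'x \<Rightarrow> ('i \<Rightarrow> 's) pmf"
    and f :: "('i \<Rightarrow> 'a) \<Rightarrow> 'x \<Rightarrow> 'x pmf" and \<delta> :: real
    and \<phi> :: "'x \<Rightarrow> ('i \<Rightarrow> 'a) pmf"
    and T :: "'i \<Rightarrow> 't set" and \<pi> :: "'x \<Rightarrow> ('i \<Rightarrow> 's) \<Rightarrow> ('i \<Rightarrow> 't) pmf"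
    and \<theta> :: 'p
  defines "G \<equiv> param_game I A u X E \<psi> f \<delta>"
    and "S \<equiv> \<lparr> signals = T, signal_dist = \<pi> \<rparr>"
  assumes latent_shocks: "E \<subseteq> Pi\<^sub>E I Es"
    and games: "\<And>\<theta>'. \<theta>' \<in> \<Theta> \<Longrightarrow> basic_game (G \<theta>')"
    and info: "\<And>\<theta>'. \<theta>' \<in> \<Theta> \<Longrightarrow> info_structure (G \<theta>') S"
    and ccp: "\<And>x. x \<in> X \<Longrightarrow> set_pmf (\<phi> x) \<subseteq> Pi\<^sub>E I A"
    and param: "\<theta> \<in> \<Theta>"
  shows "\<theta> \<in> identified_set \<Theta> G \<phi> S \<longleftrightarrow>
    (\<exists>(\<sigma> :: 'x \<Rightarrow> ('i \<Rightarrow> 's) \<Rightarrow> ('i \<Rightarrow> 't) \<Rightarrow> ('i \<Rightarrow> 'a) \<Rightarrow> real) (V :: 'i \<Rightarrow> 'x \<Rightarrow> real).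
      let v = (\<lambda>i a x s. u \<theta> i a x s + \<delta> * (\<Sum>x'\<in>X. V i x' * pmf (f a x) x'));
          dv = (\<lambda>i b' a x s. v i (a(i := b')) x s - v i a x s)
      in
        (\<forall>x\<in>X. \<forall>\<epsilon>\<in>E. \<forall>\<tau>\<in>Pi\<^sub>E I T.
           (\<forall>a\<in>Pi\<^sub>E I A. \<sigma> x \<epsilon> \<tau> a \<ge> 0) \<and> (\<Sum>a\<in>Pi\<^sub>E I A. \<sigma> x \<epsilon> \<tau> a) = 1) \<and>
        (\<forall>a\<in>Pi\<^sub>E I A. \<forall>x\<in>X.
           pmf (\<phi> x) a =
             (\<Sum>\<epsilon>\<in>E. \<Sum>\<tau>\<in>Pi\<^sub>E I T. pmf (\<psi> \<theta> x) \<epsilon> * pmf (\<pi> x \<epsilon>) \<tau> * \<sigma> x \<epsilon> \<tau> a)) \<and>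
        (\<forall>i\<in>I. \<forall>x\<in>X. \<forall>t\<in>T i. \<forall>b\<in>A i. \<forall>b'\<in>A i.
           (\<Sum>\<epsilon>\<in>E. \<Sum>\<tau> | \<tau> \<in> Pi\<^sub>E I T \<and> \<tau> i = t. \<Sum>a | a \<in> Pi\<^sub>E I A \<and> a i = b.
              pmf (\<psi> \<theta> x) \<epsilon> * pmf (\<pi> x \<epsilon>) \<tau> * \<sigma> x \<epsilon> \<tau> a * dv i b' a x (\<epsilon> i)) \<le> 0) \<and>
        (\<forall>i\<in>I. \<forall>x\<in>X.
           V i x =
             (\<Sum>\<epsilon>\<in>E. \<Sum>\<tau>\<in>Pi\<^sub>E I T. \<Sum>a\<in>Pi\<^sub>E I A.
                pmf (\<psi> \<theta> x) \<epsilon> * pmf (\<pi> x \<epsilon>) \<tau> * \<sigma> x \<epsilon> \<tau> a * u \<theta> i a x (\<epsilon> i))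
             + \<delta> * (\<Sum>a\<in>Pi\<^sub>E I A. \<Sum>x'\<in>X. pmf (\<phi> x) a * V i x' * pmf (f a x) x')))"
proof -
  let ?P = "Pi\<^sub>E I A" and ?Q = "Pi\<^sub>E I T"
  have G: "basic_game (G \<theta>)" and S: "info_structure (G \<theta>) S"
    using games info param by auto
  have sel [simp]: "players (G \<theta>) = I" "actions (G \<theta>) = A" "states (G \<theta>) = X"
    "latents (G \<theta>) = E" "prior (G \<theta>) = \<psi> \<theta>" "discount (G \<theta>) = \<delta>"
    "trans (G \<theta>) a x e = f a x" "payoff (G \<theta>) i a x e = u \<theta> i a x (e i)"
    "signals S = T" "signal_dist S = \<pi>" "profiles (G \<theta>) = ?P" "signal_profiles (G \<theta>) S = ?Q"
    for a x e i
    by (simp_all add: G_def S_def param_game_def profiles_def signal_profiles_def)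
  have finP: "finite ?P" using finite_profiles[OF G] by simp
  \<comment> \<open>After unfolding, independence of transitions from the latent state reads
    \<open>f a x = f a x\<close>, which \<open>refl\<close> discharges.\<close>
  note mce_iff = mce_iff_ccp_values[OF G S, of _ f \<phi>, unfolded sel, OF _ refl]
  show ?thesis
    unfolding Let_def
  proof (rule iffI, goal_cases)
    case 1
    then obtain p where mce: "markov_correlated_equilibrium (G \<theta>) S p"
      and ccp_eq: "\<And>x a. x \<in> X \<Longrightarrow> a \<in> ?P \<Longrightarrow> pmf (\<phi> x) a =
        (\<Sum>e\<in>E. \<Sum>\<tau>\<in>?Q. pmf (\<psi> \<theta> x) e * pmf (\<pi> x e) \<tau> * pmf (p x e \<tau>) a)"
      by (auto simp: identified_set_def mce_ccps_def)
    then have p: "decision_rule (G \<theta>) S p" by (simp add: markov_correlated_equilibrium_def)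
    have "(\<Sum>a\<in>?P. pmf (p x e \<tau>) a) = 1" if "x \<in> X" "e \<in> E" "\<tau> \<in> ?Q" for x e \<tau>
      using p that finP by (intro sum_pmf_eq_1) (auto simp: decision_rule_def)
    \<comment> \<open>The vector \<open>V\<close> comes from \<open>mce_iff\<close>;
      \<open>v\<close> in the theorem is \<open>action_value\<close> unfolded.\<close>
    with mce_iff[OF p ccp_eq] mce ccp_eq show ?case
      by (intro exI[where x = "\<lambda>x e \<tau> a. pmf (p x e \<tau>) a"])
        (simp add: action_value_def)
  next
    case 2
    then obtain \<sigma> V where \<sigma>: "\<forall>x\<in>X. \<forall>e\<in>E. \<forall>\<tau>\<in>?Q.
        (\<forall>a\<in>?P. \<sigma> x e \<tau> a \<ge> 0) \<and> (\<Sum>a\<in>?P. \<sigma> x e \<tau> a) = 1"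
      and conds: "\<forall>a\<in>?P. \<forall>x\<in>X. pmf (\<phi> x) a =
        (\<Sum>e\<in>E. \<Sum>\<tau>\<in>?Q. pmf (\<psi> \<theta> x) e * pmf (\<pi> x e) \<tau> * \<sigma> x e \<tau> a)"
      "\<forall>i\<in>I. \<forall>x\<in>X. \<forall>t\<in>T i. \<forall>b\<in>A i. \<forall>b'\<in>A i.
        (\<Sum>e\<in>E. \<Sum>\<tau> | \<tau> \<in> ?Q \<and> \<tau> i = t. \<Sum>a | a \<in> ?P \<and> a i = b.
          pmf (\<psi> \<theta> x) e * pmf (\<pi> x e) \<tau> * \<sigma> x e \<tau> a
            * (action_value (G \<theta>) i (V i) (a(i := b')) x e - action_value (G \<theta>) i (V i) a x e)) \<le> 0"
      "\<forall>i\<in>I. \<forall>x\<in>X. V i x =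
        (\<Sum>e\<in>E. \<Sum>\<tau>\<in>?Q. \<Sum>a\<in>?P. pmf (\<psi> \<theta> x) e * pmf (\<pi> x e) \<tau> * \<sigma> x e \<tau> a * u \<theta> i a x (e i))
        + \<delta> * (\<Sum>a\<in>?P. \<Sum>x'\<in>X. pmf (\<phi> x) a * V i x' * pmf (f a x) x')"
      \<comment> \<open>Obedience is restated through \<open>action_value\<close> to match
        \<open>mce_iff\<close>.\<close>
      by (elim exE conjE) (rule that; (unfold action_value_def sel)?; assumption)
    have "\<forall>x\<in>X. \<forall>e\<in>E. \<forall>\<tau>\<in>?Q. \<exists>p. set_pmf p \<subseteq> ?P \<and> (\<forall>a\<in>?P. pmf p a = \<sigma> x e \<tau> a)"
      using \<sigma> by (intro ballI pmf_of_weights[OF finP]) auto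
    then obtain p where p: "\<And>x e \<tau>. x \<in> X \<Longrightarrow> e \<in> E \<Longrightarrow> \<tau> \<in> ?Q \<Longrightarrow>
        set_pmf (p x e \<tau>) \<subseteq> ?P \<and> (\<forall>a\<in>?P. pmf (p x e \<tau>) a = \<sigma> x e \<tau> a)"
      by metis
    then have rule: "decision_rule (G \<theta>) S p" by (simp add: decision_rule_def)
    \<comment> \<open>The chosen \<open>p\<close> matches \<open>\<sigma>\<close> on the carriers
      only, so the sums below are rewritten by congruence under membership.\<close>
    have eq: "pmf (p x e \<tau>) a = \<sigma> x e \<tau> a" if "x \<in> X" "e \<in> E" "\<tau> \<in> ?Q" "a \<in> ?P" for x e \<tau> a
      using p that by blast
    have ccp_eq: "pmf (\<phi> x) a =
        (\<Sum>e\<in>E. \<Sum>\<tau>\<in>?Q. pmf (\<psi> \<theta> x) e * pmf (\<pi> x e) \<tau> * pmf (p x e \<tau>) a)"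
      if "x \<in> X" "a \<in> ?P" for x a
      using conds(1) that by (simp add: eq cong: sum.cong)
    have "markov_correlated_equilibrium (G \<theta>) S p"
    proof (rule iffD2[OF mce_iff[OF rule ccp_eq]], assumption, assumption, intro exI[where x = V] conjI, goal_cases)
      case 1
      show ?case
      proof (intro ballI, goal_cases)
        case (1 i x t b b')
        show ?case
          \<comment> \<open>The deviation \<open>a(i := b')\<close> enters only
            \<open>action_value\<close>, so the weights are compared at the recommended profile
            \<open>a\<close> alone.\<close>
          by (rule ord_eq_le_trans[OF _ conds(2)[rule_format, OF 1]])
            (auto intro!: sum.cong simp: eq 1)
      qed
    next
      case 2
      show ?case
        by (intro ballI, rule trans[OF conds(3)[rule_format]]) (simp_all add: eq cong: sum.cong)
    qed
    then show ?case
      using param ccp_eq by (auto simp: identified_set_def mce_ccps_def)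
  qed
qed

end
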